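(* Let $k,\ell\in\mathcal{K}$; let $\{v^t\}_{t\in\mathcal{T}}$ be a Farkas certificate induced by (IP-$k$) and the disjunction $\{\mathcal{X}^t\}_{t\in\mathcal{T}}$; let $\{(\alpha^{h},\beta^{h})\}_{h\in\mathcal{K}}$ be the associated family of Farkas parametric disjunctive inequalities; and for each $t\in\mathcal{T}$ let $\mathcal{A}^t$ be a basis determining $v^t$. Then $(\alpha^\ell,\beta^\ell)$ supports $\mathcal{P}_D^\ell=\operatorname{cl}\operatorname{conv}\left(\bigcup_{t\in\mathcal{T}}\mathcal{Q}^{\ell t}\right)$ if both of the following hold: 1. $\{v^t\}_{t\in\mathcal{T}}$ is induced by (IP-$\ell$) and $\{\mathcal{X}^t\}_{t\in\mathcal{T}}$; and 2. $\mathcal{A}^t$ is feasible for $\mathcal{Q}^{\ell t}$ for all $t\in\mathcal{T}$.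
   Context: Setting. $\mathcal{K}$ indexes a family of mixed-integer linear programs with the same $n$ variables, the same number $m$ of constraints and the same index set $\mathcal{I}\subseteq[n]=\{1,\dots,n\}$ of integer variables. Instance (IP-$k$) is $\min\{c^k x : x\in \mathcal{P}_I^k\}$, where $\mathcal{P}^k=\{x\in\mathbb{R}^n : A^kx\ge b^k\}$, $A^k\in\mathbb{Q}^{m\times n}$, $b^k\in\mathbb{Q}^m$, and $\mathcal{P}_I^k=\{x\in \mathcal{P}^k : x_j\in\mathbb{Z}\ \forall j\in\mathcal{I}\}$. Standing assumption: for every $k\in\mathcal{K}$ the constraints $A^kx\ge b^k$ include nonnegative lower and upper bounds on all variables; in particular $\mathcal{P}^k\subseteq\mathbb{R}^n_{\ge 0}$ and $\mathcal{P}^k$ is bounded. Disjunctions. $\{\mathcal{X}^t\}_{t\in\mathcal{T}}$ is a collection indexed by a finite nonempty set $\mathcal{T}$, with $\mathcal{X}^t=\{x\in\mathbb{R}^n : D^tx\ge D^t_0\}$, $D^t\in\mathbb{Q}^{q_t\times n}$, $D_0^t\in\mathbb{Q}^{q_t}$ (these sets are hyperrectangles obtained by restricting bounds on one or more variables), valid for the instances in the sense that $\mathcal{P}_I^k\subseteq\bigcup_{t\in\mathcal{T}}\mathcal{X}^t$ for all $k\in\mathcal{K}$. The description $(D^t,D^t_0)$ does not depend on the instance. For $k\in\mathcal{K}$, $t\in\mathcal{T}$ put $$A^{kt}=\begin{bmatrix}A^k\\ D^t\end{bmatrix},\quad b^{kt}=\begin{bmatrix}b^k\\ D^t_0\end{bmatrix},\quad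 \mathcal{Q}^{kt}=\mathcal{P}^k\cap \mathcal{X}^t=\{x\in\mathbb{R}^n: A^{kt}x\ge b^{kt}\}.$$ The disjunctive hull is $\mathcal{P}_D^k=\operatorname{cl}\operatorname{conv}(\bigcup_{t\in\mathcal{T}}\mathcal{Q}^{kt})$. Let $\mathcal{T}^k=\{t\in\mathcal{T}:\mathcal{Q}^{kt}\neq\emptyset\}$. Farkas certificates. A Farkas certificate is a family $\{v^t\}_{t\in\mathcal{T}}$ of nonnegative row vectors $v^t\in\mathbb{R}_{\ge 0}^{1\times(m+q_t)}$. It is induced by (IP-$k$) and $\{\mathcal{X}^t\}_{t\in\mathcal{T}}$ if $v^{t_1}A^{kt_1}=v^{t_2}A^{kt_2}$ for all $t_1,t_2\in\mathcal{T}^k$; by convention $v^t=0$ for terms $t$ that are infeasible for the inducing instance. Bases. A basis $\mathcal{A}^t\subseteq[m+q_t]$ is a set of indices of $n$ linearly independent constraints (rows of $A^{kt}$). It determines $v^t$ if $\{i\in[m+q_t]: v^t_i>0\}\subseteq\mathcal{A}^t$. It is feasible for $\mathcal{Q}^{\ell t}$ if the rows of $A^{\ell t}$ indexed by $\mathcal{A}^t$ form an invertible matrix $A^{\ell t}_{\mathcal{A}^t}$ and the basic solution $(A^{\ell t}_{\mathcal{A}^t})^{-1}b^{\ell t}_{\mathcal{A}^t}$ lies in $\mathcal{Q}^{\ell t}$. Farkas parametric disjunctive inequalities. The family associated with $\{v^t\}_{t\in\mathcal{T}}$ and $\{\mathcal{X}^t\}_{t\in\mathcal{T}}$ is $\{(\alpha^h,\beta^h)\}_{h\in\mathcal{K}}$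 with $\alpha^h_j=\max_{t\in\mathcal{T}}\{v^tA^{ht}_{\cdot j}\}$ for $j\in[n]$ ($A^{ht}_{\cdot j}$ the $j$-th column of $A^{ht}$) and $\beta^h=\min_{t\in\mathcal{T}}\{v^tb^{ht}\}$. Support. A pair $(\alpha,\beta)\in\mathbb{R}^n\times\mathbb{R}$ is valid for a set $S$ if $\alpha^Tx\ge\beta$ for all $x\in S$; it supports a polyhedron $\mathcal{P}$ if it is valid for $\mathcal{P}$ and there exists $x\in\mathcal{P}$ with $\alpha^Tx=\beta$. *)

theory Defs
  imports "HOL-Analysis.Analysis"
begin

text \<open>
  The ambient space is \<open>real ^ 'n\<close>. Numbers of constraints differ from term to term, so
  constraints are numbered by natural numbers. A system \<open>S\<close> has the rows \<open>i < nconstr S\<close>,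
  which state \<open>rhs S i \<le> lhs S i \<bullet> x\<close>, and values at larger \<open>i\<close> are irrelevant.
\<close>

record ('n::finite) lin_sys =
  nconstr :: nat
  lhs :: "nat \<Rightarrow> real ^ 'n"
  rhs :: "nat \<Rightarrow> real"

definition feasible_set :: "'n::finite lin_sys \<Rightarrow> (real ^ 'n) set" where
  "feasible_set S = {x. \<forall>i<nconstr S. lhs S i \<bullet> x \<ge> rhs S i}"

definition rational_sys :: "'n::finite lin_sys \<Rightarrow> bool" where
  "rational_sys S \<longleftrightarrow> (\<forall>i<nconstr S. rhs S i \<in> \<rat> \<and> (\<forall>j. lhs S i $ j \<in> \<rat>))"

definition stack :: "'n::finite lin_sys \<Rightarrow> 'n lin_sys \<Rightarrow> 'n lin_sys" where
  "stack S R = \<lparr>nconstr = nconstr S + nconstr R,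
     lhs = (\<lambda>i. if i < nconstr S then lhs S i else lhs R (i - nconstr S)),
     rhs = (\<lambda>i. if i < nconstr S then rhs S i else rhs R (i - nconstr S))\<rparr>"

lemma feasible_set_stack: "feasible_set (stack S R) = feasible_set S \<inter> feasible_set R"
proof (rule set_eqI)
  fix x
  let ?P = "\<lambda>i. lhs (stack S R) i \<bullet> x \<ge> rhs (stack S R) i"
  have split: "(\<forall>i<p + q. Q i) \<longleftrightarrow> (\<forall>i<p. Q i) \<and> (\<forall>i<q. Q (p + i))"
    for p q :: nat and Q
    by (metis add_less_cancel_left le_add_diff_inverse not_less trans_less_add1)
  have "x \<in> feasible_set (stack S R) \<longleftrightarrow> (\<forall>i<nconstr S + nconstr R. ?P i)"
    by (simp add: feasible_set_def stack_def)
  also have "\<dots> \<longleftrightarrow> (\<forall>i<nconstr S. ?P i) \<and> (\<forall>i<nconstr R. ?P (nconstr S + i))"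
    by (rule split)
  also have "\<dots> \<longleftrightarrow> x \<in> feasible_set S \<inter> feasible_set R"
    by (simp add: feasible_set_def stack_def)
  finally show "x \<in> feasible_set (stack S R) \<longleftrightarrow> x \<in> feasible_set S \<inter> feasible_set R" .
qed

record ('n::finite) milp =
  cost :: "real ^ 'n"
  constr :: "'n lin_sys"

text \<open>
  A constraint \<open>axis j a \<bullet> x \<ge> r\<close> reads \<open>a * x $ j \<ge> r\<close>. It is the lower bound \<open>r / a\<close>
  on \<open>x $ j\<close> if \<open>a > 0\<close> and the upper bound \<open>r / a\<close> if \<open>a < 0\<close>.
\<close>

definition nonneg_bounds :: "'n::finite lin_sys \<Rightarrow> bool" where
  "nonneg_bounds S \<longleftrightarrow>
     (\<forall>j. (\<exists>i<nconstr S. \<exists>a>0. lhs S i = axis j a \<and> rhs S i / a \<ge> 0) \<and>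
          (\<exists>i<nconstr S. \<exists>a<0. lhs S i = axis j a \<and> rhs S i / a \<ge> 0))"

definition milp_family :: "'k set \<Rightarrow> nat \<Rightarrow> ('k \<Rightarrow> 'n::finite milp) \<Rightarrow> bool" where
  "milp_family K m IP \<longleftrightarrow>
     (\<forall>k\<in>K. nconstr (constr (IP k)) = m \<and> rational_sys (constr (IP k)) \<and>
        nonneg_bounds (constr (IP k)))"

definition mi_feasible_set :: "'n::finite set \<Rightarrow> 'n milp \<Rightarrow> (real ^ 'n) set" where
  "mi_feasible_set I M = {x \<in> feasible_set (constr M). \<forall>j\<in>I. x $ j \<in> \<int>}"

definition bound_restriction :: "(real ^ 'n::finite) set \<Rightarrow> bool" where
  "bound_restriction X \<longleftrightarrow>
     (\<exists>L U l u. L \<union> U \<noteq> {} \<and> X = {x. (\<forall>j\<in>L. l j \<le> x $ j) \<and> (\<forall>j\<in>U. x $ j \<le> u j)})"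

definition valid_disjunction ::
  "'n::finite set \<Rightarrow> 'k set \<Rightarrow> ('k \<Rightarrow> 'n milp) \<Rightarrow> 't set \<Rightarrow> ('t \<Rightarrow> 'n lin_sys) \<Rightarrow> bool" where
  "valid_disjunction I K IP T D \<longleftrightarrow>
     finite T \<and> T \<noteq> {} \<and>
     (\<forall>t\<in>T. rational_sys (D t) \<and> bound_restriction (feasible_set (D t))) \<and>
     (\<forall>k\<in>K. mi_feasible_set I (IP k) \<subseteq> (\<Union>t\<in>T. feasible_set (D t)))"

abbreviation term_sys :: "'n::finite milp \<Rightarrow> ('t \<Rightarrow> 'n lin_sys) \<Rightarrow> 't \<Rightarrow> 'n lin_sys" where
  "term_sys M D t \<equiv> stack (constr M) (D t)"

definition disjunctive_hull ::
  "'n::finite milp \<Rightarrow> 't set \<Rightarrow> ('t \<Rightarrow> 'n lin_sys) \<Rightarrow> (real ^ 'n) set" where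
  "disjunctive_hull M T D = closure (convex hull (\<Union>t\<in>T. feasible_set (term_sys M D t)))"

definition feasible_terms ::
  "'n::finite milp \<Rightarrow> 't set \<Rightarrow> ('t \<Rightarrow> 'n lin_sys) \<Rightarrow> 't set" where
  "feasible_terms M T D = {t \<in> T. feasible_set (term_sys M D t) \<noteq> {}}"

definition comb_lhs :: "(nat \<Rightarrow> real) \<Rightarrow> 'n::finite lin_sys \<Rightarrow> real ^ 'n" where
  "comb_lhs v S = (\<chi> j. \<Sum>i<nconstr S. v i * lhs S i $ j)"

definition comb_rhs :: "(nat \<Rightarrow> real) \<Rightarrow> 'n::finite lin_sys \<Rightarrow> real" where
  "comb_rhs v S = (\<Sum>i<nconstr S. v i * rhs S i)"

definition farkas_certificate ::
  "nat \<Rightarrow> 't set \<Rightarrow> ('t \<Rightarrow> 'n::finite lin_sys) \<Rightarrow> ('t \<Rightarrow> nat \<Rightarrow> real) \<Rightarrow> bool" where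
  "farkas_certificate m T D v \<longleftrightarrow> (\<forall>t\<in>T. \<forall>i<m + nconstr (D t). v t i \<ge> 0)"

definition induced_by ::
  "'n::finite milp \<Rightarrow> 't set \<Rightarrow> ('t \<Rightarrow> 'n lin_sys) \<Rightarrow> ('t \<Rightarrow> nat \<Rightarrow> real) \<Rightarrow> bool" where
  "induced_by M T D v \<longleftrightarrow>
     (\<forall>t1\<in>feasible_terms M T D. \<forall>t2\<in>feasible_terms M T D.
        comb_lhs (v t1) (term_sys M D t1) = comb_lhs (v t2) (term_sys M D t2)) \<and>
     (\<forall>t\<in>T - feasible_terms M T D. \<forall>i<nconstr (term_sys M D t). v t i = 0)"

definition is_basis :: "'n::finite lin_sys \<Rightarrow> nat set \<Rightarrow> bool" where
  "is_basis S B \<longleftrightarrow> B \<subseteq> {..<nconstr S} \<and> card B = CARD('n) \<and>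
     inj_on (lhs S) B \<and> independent (lhs S ` B)"

definition determines :: "'n::finite lin_sys \<Rightarrow> nat set \<Rightarrow> (nat \<Rightarrow> real) \<Rightarrow> bool" where
  "determines S B v \<longleftrightarrow> {i. i < nconstr S \<and> v i > 0} \<subseteq> B"

text \<open>
  Square matrices have rows indexed by \<open>'n\<close>, so the submatrix with row set \<open>B\<close> needs an
  enumeration \<open>\<sigma>\<close> of \<open>B\<close> by \<open>'n\<close>. Changing \<open>\<sigma>\<close> permutes the rows of the matrix and of the
  right-hand side alike, hence affects neither invertibility nor the basic solution.
\<close>

definition sub_lhs :: "'n::finite lin_sys \<Rightarrow> ('n \<Rightarrow> nat) \<Rightarrow> real ^ 'n ^ 'n" where
  "sub_lhs S \<sigma> = (\<chi> i. lhs S (\<sigma> i))"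

definition sub_rhs :: "'n::finite lin_sys \<Rightarrow> ('n \<Rightarrow> nat) \<Rightarrow> real ^ 'n" where
  "sub_rhs S \<sigma> = (\<chi> i. rhs S (\<sigma> i))"

definition feasible_basis :: "'n::finite lin_sys \<Rightarrow> nat set \<Rightarrow> bool" where
  "feasible_basis S B \<longleftrightarrow>
     (\<exists>\<sigma>. bij_betw \<sigma> UNIV B \<and> invertible (sub_lhs S \<sigma>) \<and>
        matrix_inv (sub_lhs S \<sigma>) *v sub_rhs S \<sigma> \<in> feasible_set S)"

definition fpdi_lhs ::
  "'t set \<Rightarrow> ('t \<Rightarrow> 'n::finite lin_sys) \<Rightarrow> ('t \<Rightarrow> nat \<Rightarrow> real) \<Rightarrow> 'n milp \<Rightarrow> real ^ 'n" where
  "fpdi_lhs T D v M = (\<chi> j. Max ((\<lambda>t. comb_lhs (v t) (term_sys M D t) $ j) ` T))"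

definition fpdi_rhs ::
  "'t set \<Rightarrow> ('t \<Rightarrow> 'n::finite lin_sys) \<Rightarrow> ('t \<Rightarrow> nat \<Rightarrow> real) \<Rightarrow> 'n milp \<Rightarrow> real" where
  "fpdi_rhs T D v M = Min ((\<lambda>t. comb_rhs (v t) (term_sys M D t)) ` T)"

definition valid_ineq :: "real ^ 'n::finite \<Rightarrow> real \<Rightarrow> (real ^ 'n) set \<Rightarrow> bool" where
  "valid_ineq \<alpha> \<beta> S \<longleftrightarrow> (\<forall>x\<in>S. \<alpha> \<bullet> x \<ge> \<beta>)"

definition supports :: "real ^ 'n::finite \<Rightarrow> real \<Rightarrow> (real ^ 'n) set \<Rightarrow> bool" where
  "supports \<alpha> \<beta> S \<longleftrightarrow> valid_ineq \<alpha> \<beta> S \<and> (\<exists>x\<in>S. \<alpha> \<bullet> x = \<beta>)"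

end

theory Submission imports Defs begin

text \<open>
  Every term is feasible for the target instance because it has a feasible basis, so all aggregated
  left-hand sides \<open>comb_lhs (v t)\<close> coincide with \<open>\<alpha>\<close>, and each \<open>Q\<^sup>t\<close> lies in the closed half-space
  \<open>{x. \<alpha> \<bullet> x \<ge> \<beta>}\<close>. At a term attaining the minimum \<open>\<beta>\<close>, complementary slackness makes the
  inequality tight at the basic solution.
\<close>

lemma inner_comb_lhs: "comb_lhs v S \<bullet> x = (\<Sum>i<nconstr S. v i * (lhs S i \<bullet> x))"
proof -
  have "comb_lhs v S = (\<Sum>i<nconstr S. v i *\<^sub>R lhs S i)"
    by (simp add: vec_eq_iff comb_lhs_def)
  then show ?thesis
    by (simp add: inner_sum_left)
qed

text \<open>Weak duality: a nonnegative multiplier preserves the sense of its row, and the scaled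
  rows add up.\<close>

lemma comb_rhs_le_inner_comb_lhs:
  assumes "\<And>i. i < nconstr S \<Longrightarrow> v i \<ge> 0" and "x \<in> feasible_set S"
  shows "comb_rhs v S \<le> comb_lhs v S \<bullet> x"
  using assms
  by (auto simp: inner_comb_lhs comb_rhs_def feasible_set_def intro!: sum_mono mult_left_mono)

text \<open>Rows with multiplier zero vanish from both sums, so slack there is harmless; the signs
  of the multipliers do not matter.\<close>

lemma inner_comb_lhs_eq_comb_rhs:
  assumes "\<And>i. i < nconstr S \<Longrightarrow> v i \<noteq> 0 \<Longrightarrow> lhs S i \<bullet> x = rhs S i"
  shows "comb_lhs v S \<bullet> x = comb_rhs v S"
  unfolding inner_comb_lhs comb_rhs_def using assms by (intro sum.cong) auto

text \<open>\<open>matrix_inv\<close> is a choice among two-sided inverses, and invertibility says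
  that there is one to choose.\<close>

lemma invertible_matrix_inv_right:
  assumes "invertible A"
  shows "A ** matrix_inv A = mat 1"
  unfolding matrix_inv_def
  using someI_ex[OF assms[unfolded invertible_def]] by (rule conjunct1)

text \<open>Replaces the matrix formula for the basic solution by one equation per row of the basis,
  so that the enumeration \<sigma> disappears from later arguments.\<close>

lemma feasible_basis_solution:
  assumes "feasible_basis S B"
  obtains x where "x \<in> feasible_set S" and "\<And>i. i \<in> B \<Longrightarrow> lhs S i \<bullet> x = rhs S i"
proof -
  obtain \<sigma> where \<sigma>: "bij_betw \<sigma> UNIV B" and inv: "invertible (sub_lhs S \<sigma>)"
    and feas: "matrix_inv (sub_lhs S \<sigma>) *v sub_rhs S \<sigma> \<in> feasible_set S"
    using assms by (auto simp: feasible_basis_def)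
  define x where "x = matrix_inv (sub_lhs S \<sigma>) *v sub_rhs S \<sigma>"
  have "sub_lhs S \<sigma> *v x = sub_rhs S \<sigma>"
    using inv by (simp add: x_def matrix_vector_mul_assoc invertible_matrix_inv_right)
  then have "lhs S (\<sigma> j) \<bullet> x = rhs S (\<sigma> j)" for j
    by (simp add: vec_eq_iff sub_lhs_def sub_rhs_def matrix_vector_mul_component)
  moreover have "B = range \<sigma>"
    using \<sigma> by (simp add: bij_betw_def)
  ultimately show thesis
    using that[of x] feas by (auto simp: x_def)
qed

text \<open>A closed half-space is both closed and convex, so it absorbs the hull and then the
  closure.\<close>

lemma valid_ineq_closure_convex_hull:
  assumes "valid_ineq \<alpha> \<beta> S"
  shows "valid_ineq \<alpha> \<beta> (closure (convex hull S))"
proof -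
  have "closure (convex hull S) \<subseteq> {x. \<alpha> \<bullet> x \<ge> \<beta>}"
    using assms
    by (intro closure_minimal hull_minimal closed_halfspace_ge convex_halfspace_ge)
      (auto simp: valid_ineq_def)
  then show ?thesis
    by (auto simp: valid_ineq_def)
qed

theorem lemma1:
  fixes K :: "'k set" and IP :: "'k \<Rightarrow> 'n::finite milp" and m :: nat and I :: "'n set"
    and T :: "'t set" and D :: "'t \<Rightarrow> 'n lin_sys"
    and v :: "'t \<Rightarrow> nat \<Rightarrow> real" and B :: "'t \<Rightarrow> nat set" and k l :: 'k
  assumes "milp_family K m IP"
    and "valid_disjunction I K IP T D"
    and "k \<in> K" and "l \<in> K"
    and "farkas_certificate m T D v"
    and "induced_by (IP k) T D v"
    and "\<And>t. t \<in> T \<Longrightarrow> is_basis (term_sys (IP k) D t) (B t)"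
    and "\<And>t. t \<in> T \<Longrightarrow> determines (term_sys (IP k) D t) (B t) (v t)"
    and "induced_by (IP l) T D v"
    and "\<And>t. t \<in> T \<Longrightarrow> feasible_basis (term_sys (IP l) D t) (B t)"
  shows "supports (fpdi_lhs T D v (IP l)) (fpdi_rhs T D v (IP l)) (disjunctive_hull (IP l) T D)"
proof -
  let ?S = "term_sys (IP l) D"
  let ?\<alpha> = "fpdi_lhs T D v (IP l)" and ?\<beta> = "fpdi_rhs T D v (IP l)"
  have T: "finite T" "T \<noteq> {}"
    using assms(2) by (auto simp: valid_disjunction_def)
  have size: "nconstr (term_sys (IP h) D t) = m + nconstr (D t)" if "h \<in> K" for h t
    using assms(1) that by (simp add: milp_family_def stack_def)
  have nonneg: "v t i \<ge> 0" if "t \<in> T" "i < nconstr (?S t)" for t i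
    using assms(5) that size[OF assms(4)] by (simp add: farkas_certificate_def)
  have "feasible_set (?S t) \<noteq> {}" if "t \<in> T" for t
    using feasible_basis_solution[OF assms(10)[OF that]] by blast
  then have "feasible_terms (IP l) T D = T"
    by (auto simp: feasible_terms_def)
  then have "comb_lhs (v s) (?S s) = comb_lhs (v t) (?S t)" if "s \<in> T" "t \<in> T" for s t
    using assms(9) that unfolding induced_by_def by blast
  \<comment> \<open>The maximum in each coordinate is taken over a constant family; as
    \<open>T\<close> is nonempty, the image is a singleton and \<open>Max\<close> returns its
    element.\<close>
  then have image: "(\<lambda>s. comb_lhs (v s) (?S s) $ j) ` T = (\<lambda>_. comb_lhs (v t) (?S t) $ j) ` T"
    if "t \<in> T" for t j
    using that by (intro image_cong refl arg_cong[where f = "\<lambda>w. w $ j"])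
  have \<alpha>: "?\<alpha> = comb_lhs (v t) (?S t)" if "t \<in> T" for t
    unfolding fpdi_lhs_def image[OF that] using T by (simp add: vec_eq_iff)
  have "valid_ineq ?\<alpha> ?\<beta> (\<Union>t\<in>T. feasible_set (?S t))"
    unfolding valid_ineq_def
  proof clarify
    fix x t assume t: "t \<in> T" and x: "x \<in> feasible_set (?S t)"
    have "?\<beta> \<le> comb_rhs (v t) (?S t)"
      using T t by (simp add: fpdi_rhs_def)
    also have "\<dots> \<le> ?\<alpha> \<bullet> x"
      using comb_rhs_le_inner_comb_lhs[OF nonneg[OF t] x] \<alpha>[OF t] by simp
    finally show "?\<beta> \<le> ?\<alpha> \<bullet> x" .
  qed
  then have valid: "valid_ineq ?\<alpha> ?\<beta> (disjunctive_hull (IP l) T D)"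
    unfolding disjunctive_hull_def by (rule valid_ineq_closure_convex_hull)
  have "?\<beta> \<in> (\<lambda>t. comb_rhs (v t) (?S t)) ` T"
    unfolding fpdi_rhs_def using T by (intro Min_in) auto
  then obtain t where t: "t \<in> T" and \<beta>: "?\<beta> = comb_rhs (v t) (?S t)"
    by blast
  obtain x where x: "x \<in> feasible_set (?S t)"
    and tight: "\<And>i. i \<in> B t \<Longrightarrow> lhs (?S t) i \<bullet> x = rhs (?S t) i"
    using feasible_basis_solution[OF assms(10)[OF t]] by blast
  \<comment> \<open>\<open>determines\<close> speaks of the system of instance \<open>k\<close>, but
    both instances have \<open>m + nconstr (D t)\<close> rows, so the index carries over.
    Nonnegativity turns a nonzero multiplier into a positive one.\<close>
  have "i \<in> B t" if "i < nconstr (?S t)" "v t i \<noteq> 0" for i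
    using assms(8)[OF t] nonneg[OF t that(1)] that size[OF assms(3)] size[OF assms(4)]
    by (auto simp: determines_def)
  then have "?\<alpha> \<bullet> x = ?\<beta>"
    unfolding \<alpha>[OF t] \<beta> by (intro inner_comb_lhs_eq_comb_rhs tight)
  moreover have "x \<in> disjunctive_hull (IP l) T D"
    unfolding disjunctive_hull_def using t x
    by (meson UN_I closure_subset hull_inc subsetD)
  ultimately show ?thesis
    using valid by (auto simp: supports_def)
qed

end
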